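(* Let $P$ be a bounded and graded poset of rank $n$, let $\Lambda$ be a poset, and let $\lambda:\mathcal E(P)\to\Lambda$ be an EL-labeling of $P$. Let $t\ge 1$ and let $\lambda^{(t)}:\mathcal E(P^{(t)})\to\Lambda^t$ be the induced edge labeling of the $t$-fold Segre power, $\lambda^{(t)}((x_1,\ldots,x_t)\lessdot(y_1,\ldots,y_t))=(\lambda(x_1\lessdot y_1),\ldots,\lambda(x_t\lessdot y_t))$. Then $\lambda^{(t)}$ is an EL-labeling of $P^{(t)}$. Moreover, identifying a maximal chain $C$ of $P^{(t)}$ (from $\hat 0$ to $\hat 1$) with the $t$-tuple $(c_1,\ldots,c_t)$ of maximal chains of $P$ formed by its coordinates, the following hold: (1) $j\in[n-1]$ is a descent of $(c_1,\ldots,c_t)$ (with respect to $\lambda^{(t)}$) if and only if $j$ is not a common ascent of $c_1,\ldots,c_t$ (with respect to $\lambda$); hence $\mathrm{Des}(c_1,\ldots,c_t)=[n-1]\setminus\bigcap_{i=1}^t\mathrm{Asc}(c_i)$. (2) The decreasing maximal chains of $P^{(t)}$ with respect to $\lambda^{(t)}$ are precisely the $t$-tuples $(c_1,\ldots,c_t)$ of maximal chains of $P$ with no common ascent. (3) For every $J\subseteq[n-1]$, $\tilde\beta_{P^{(t)}}(J)$ equals the number of $t$-tuples $(c_1,\ldots,c_t)$ of maximal chains of $P$ such that $[n-1]\setminus J$ is exactly the set of common ascents of $c_1,\ldots,c_t$. (4) For every $J\subseteq[n-1]$, $\tilde\alpha_{P^{(t)}}(J)$ equals the number of $t$-tuples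 $(c_1,\ldots,c_t)$ of maximal chains of $P$ such that $J$ contains the descent set of $(c_1,\ldots,c_t)$.
   Context: A poset is bounded if it has a least element $\hat 0$ and greatest element $\hat 1$, and graded if in every interval all maximal chains have the same length; then $\mathrm{rk}(x)$ is the length of any maximal chain from $\hat 0$ to $x$, and the rank of $P$ is $\mathrm{rk}(\hat 1)$. For $t\ge2$ the $t$-fold Segre power $P^{(t)}$ is the induced subposet of the product poset $P\times\cdots\times P$ ($t$ factors, componentwise order) consisting of tuples $(x_1,\ldots,x_t)$ with $\mathrm{rk}(x_i)=\mathrm{rk}(x_j)$ for all $i,j$; its cover relations are $(x_1,\ldots,x_t)\lessdot(y_1,\ldots,y_t)$ iff $x_i\lessdot y_i$ for all $i$; $P^{(1)}=P$. $\Lambda^t$ is the product poset with $(a_1,\ldots,a_t)\le(b_1,\ldots,b_t)$ iff $a_i\le b_i$ for all $i$. An edge labeling of $P$ is a map $\lambda:\mathcal E(P)\to\Lambda$ from the set of cover relations of $P$ to a poset $\Lambda$. For a maximal chain $c=(x=x_0\lessdot x_1\lessdot\cdots\lessdot x_m=y)$ of an interval $[x,y]$, an index $j\in[m-1]$ is an ascent if $\lambda(x_{j-1},x_j)<\lambda(x_j,x_{j+1})$ and a descent otherwise; $\mathrm{Asc}(c)$, $\mathrm{Des}(c)$ denote these sets. The chain is increasing if all its consecutive labels are strictly increasing, and decreasing if it has no ascent. Its label word is $\lambda(x_0,x_1)\lambda(x_1,x_2)\cdots\lambda(x_{m-1},x_m)$, and chains are compared lexicographically via their label words. $\lambda$ is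 an EL-labeling if every interval $[x,y]$ has a unique increasing maximal chain, and this chain lexicographically strictly precedes every other maximal chain of $[x,y]$. For $J\subseteq[n-1]$, $P_J$ is the subposet of elements of rank in $J$ together with $\hat0,\hat1$; $\tilde\alpha_P(J)$ is the number of maximal chains of $P_J$, and $\tilde\beta_P(J)=\sum_{U\subseteq J}(-1)^{|J|-|U|}\tilde\alpha_P(U)$.
   Formalization: Ascents, increasing and decreasing chains in Λ^t use strict inequality in every coordinate, or the strict product order if λ never repeats a label on two consecutive covers (with the strict product order alone the claim fails for t≥2); (3) is stated for finite P. *)

theory Defs
  imports Complex_Main "HOL-Library.FuncSet"
begin

(* A poset is a relation P with Partial_order P; its ground set is Field P, its
   non-strict order is P and its strict order is P - Id. *)

definition zero_hat :: "'a rel \<Rightarrow> 'a" where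
  "zero_hat P = (THE z. z \<in> Field P \<and> (\<forall>x\<in>Field P. (z, x) \<in> P))"

definition one_hat :: "'a rel \<Rightarrow> 'a" where
  "one_hat P = (THE z. z \<in> Field P \<and> (\<forall>x\<in>Field P. (x, z) \<in> P))"

definition bounded_poset :: "'a rel \<Rightarrow> bool" where
  "bounded_poset P \<longleftrightarrow> Partial_order P \<and>
     (\<exists>z\<in>Field P. \<forall>x\<in>Field P. (z, x) \<in> P) \<and> (\<exists>z\<in>Field P. \<forall>x\<in>Field P. (x, z) \<in> P)"

definition covers :: "'a rel \<Rightarrow> 'a rel" where
  "covers P = {(x, y) \<in> P - Id. \<nexists>z. (x, z) \<in> P - Id \<and> (z, y) \<in> P - Id}"

(* The maximal chains of the interval [x,y], as lists [x = x_0, x_1, ..., x_m = y] of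
   successive covers; such a list has length m + 1. *)
definition maximal_chains :: "'a rel \<Rightarrow> 'a \<Rightarrow> 'a \<Rightarrow> 'a list set" where
  "maximal_chains P x y =
     {c. c \<noteq> [] \<and> set c \<subseteq> Field P \<and> hd c = x \<and> last c = y \<and>
         successively (\<lambda>a b. (a, b) \<in> covers P) c}"

(* All maximal chains of an interval have the same finite length.  P need not be finite;
   requiring the set of lengths to be a singleton, hence nonempty, excludes posets such as
   the real unit interval, which have no chain of successive covers from bottom to top. *)
definition graded_poset :: "'a rel \<Rightarrow> bool" where
  "graded_poset P \<longleftrightarrow> (\<forall>(x, y)\<in>P. \<exists>m. length ` maximal_chains P x y = {Suc m})"

definition rk :: "'a rel \<Rightarrow> 'a \<Rightarrow> nat" where
  "rk P x = (THE m. \<exists>c\<in>maximal_chains P (zero_hat P) x. length c = Suc m)"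

(* Componentwise extension of a relation to t-tuples, which are lists of length t.
   If L is the order of a poset, this is the product order on its t-th power. *)
definition tuple_power :: "nat \<Rightarrow> 'a rel \<Rightarrow> 'a list rel" where
  "tuple_power t r = {(xs, ys) \<in> listrel r. length xs = t}"

definition segre_power :: "nat \<Rightarrow> 'a rel \<Rightarrow> 'a list rel" where
  "segre_power t P =
     Restr (tuple_power t P) {xs. \<forall>x\<in>set xs. \<forall>y\<in>set xs. rk P x = rk P y}"

definition power_labeling :: "('a \<times> 'a \<Rightarrow> 'l) \<Rightarrow> 'a list \<times> 'a list \<Rightarrow> 'l list" where
  "power_labeling lam = (\<lambda>(xs, ys). map lam (zip xs ys))"

definition label_word :: "('a \<times> 'a \<Rightarrow> 'l) \<Rightarrow> 'a list \<Rightarrow> 'l list" where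
  "label_word lam c = map lam (zip c (tl c))"

(* The relation S says when a label is "strictly smaller" than the next one.  For labels in
   a poset L it is L - Id.  For labels in the t-th power of L it is tuple_power t (L - Id),
   i.e. strict inequality in every coordinate.  The strict part tuple_power t L - Id of the
   product order is in general larger: (1,2) < (2,2) there, although the second coordinate
   does not ascend.  The two agree on consecutive labels of a chain if the labeling never
   repeats a label on two consecutive covers. *)
definition Asc :: "'l rel \<Rightarrow> ('a \<times> 'a \<Rightarrow> 'l) \<Rightarrow> 'a list \<Rightarrow> nat set" where
  "Asc S lam c =
     (let w = label_word lam c in {j \<in> {1..<length w}. (w ! (j - 1), w ! j) \<in> S})"

definition Des :: "'l rel \<Rightarrow> ('a \<times> 'a \<Rightarrow> 'l) \<Rightarrow> 'a list \<Rightarrow> nat set" where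
  "Des S lam c = {1..<length (label_word lam c)} - Asc S lam c"

definition increasing_chain :: "'l rel \<Rightarrow> ('a \<times> 'a \<Rightarrow> 'l) \<Rightarrow> 'a list \<Rightarrow> bool" where
  "increasing_chain S lam c \<longleftrightarrow> successively (\<lambda>a b. (a, b) \<in> S) (label_word lam c)"

definition decreasing_chain :: "'l rel \<Rightarrow> ('a \<times> 'a \<Rightarrow> 'l) \<Rightarrow> 'a list \<Rightarrow> bool" where
  "decreasing_chain S lam c \<longleftrightarrow> Asc S lam c = {}"

(* S only decides which chains are increasing; label words are always compared with respect
   to the strict part of the order L of the label poset. *)
definition EL_labeling :: "'a rel \<Rightarrow> 'l rel \<Rightarrow> 'l rel \<Rightarrow> ('a \<times> 'a \<Rightarrow> 'l) \<Rightarrow> bool" where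
  "EL_labeling P L S lam \<longleftrightarrow> lam \<in> covers P \<rightarrow> Field L \<and>
     (\<forall>(x, y)\<in>P.
        (\<exists>!c. c \<in> maximal_chains P x y \<and> increasing_chain S lam c) \<and>
        (\<forall>c\<in>maximal_chains P x y. increasing_chain S lam c \<longrightarrow>
           (\<forall>d\<in>maximal_chains P x y. d \<noteq> c \<longrightarrow>
              (label_word lam c, label_word lam d) \<in> lexord (L - Id))))"

definition rank_selected :: "'a rel \<Rightarrow> nat set \<Rightarrow> 'a rel" where
  "rank_selected P J = Restr P ({x \<in> Field P. rk P x \<in> J} \<union> {zero_hat P, one_hat P})"

definition alpha :: "'a rel \<Rightarrow> nat set \<Rightarrow> nat" where
  "alpha P J = card (maximal_chains (rank_selected P J) (zero_hat P) (one_hat P))"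

definition beta :: "'a rel \<Rightarrow> nat set \<Rightarrow> int" where
  "beta P J = (\<Sum>U\<in>Pow J. (- 1) ^ (card J - card U) * int (alpha P U))"

definition full_chains :: "'a rel \<Rightarrow> 'a list set" where
  "full_chains P = maximal_chains P (zero_hat P) (one_hat P)"

(* A chain of t-tuples and the t-tuple of its coordinate chains are transposes of each
   other as lists of lists. *)
definition chain_tuples :: "nat \<Rightarrow> 'a rel \<Rightarrow> 'a list list set" where
  "chain_tuples t P = {cs. length cs = t \<and> set cs \<subseteq> full_chains P}"

definition common_ascents :: "'l rel \<Rightarrow> ('a \<times> 'a \<Rightarrow> 'l) \<Rightarrow> 'a list list \<Rightarrow> nat set" where
  "common_ascents S lam cs = (\<Inter>c\<in>set cs. Asc S lam c)"

end

(* The cover relations of the Segre power are the tuples of covers, so transposition identifies its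
   maximal chains in an interval with tuples of maximal chains of P. Consecutive labels ascend in
   the power iff they ascend in every coordinate; hence a chain is increasing iff all its
   coordinates are, and the tuple of the increasing chains is the unique increasing chain. At the
   first position where its label word differs from that of another chain, it is at most the other
   one in each coordinate, because each coordinate word is lexicographically first.

   The formulas for alpha and beta hold for every bounded graded poset whose intervals have unique
   increasing maximal chains: filling the gaps of a maximal chain of P_J with increasing chains
   gives a bijection onto the maximal chains with descent set contained in J, and Moebius
   inversion over subsets then counts those with descent set exactly J. *)

theory Submission
  imports Defs
begin

section \<open>Label words, ranks and maximal chains in a bounded graded poset\<close>

lemma length_label_word [simp]: "length (label_word lam c) = length c - 1"
  by (simp add: label_word_def)

lemma label_word_nth: "Suc j < length c \<Longrightarrow> label_word lam c ! j = lam (c ! j, c ! Suc j)"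
  by (simp add: label_word_def nth_tl)

locale bounded_graded_poset =
  fixes P :: "'a rel"
  assumes bounded: "bounded_poset P" and graded: "graded_poset P"
begin

lemma po: "Refl P" "trans P" "antisym P"
  using bounded by (auto simp: bounded_poset_def partial_order_on_def preorder_on_def)

lemma P_refl: "x \<in> Field P \<Longrightarrow> (x, x) \<in> P"
  using po by (auto simp: refl_on_def)

lemma P_trans: "(x, y) \<in> P \<Longrightarrow> (y, z) \<in> P \<Longrightarrow> (x, z) \<in> P"
  using po by (auto dest: transD)

lemma P_antisym: "(x, y) \<in> P \<Longrightarrow> (y, x) \<in> P \<Longrightarrow> x = y"
  using po by (auto dest: antisymD)

lemma Field1: "(x, y) \<in> P \<Longrightarrow> x \<in> Field P" and Field2: "(x, y) \<in> P \<Longrightarrow> y \<in> Field P"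
  by (auto simp: Field_def)

lemma zero_hat_eqI: "z \<in> Field P \<Longrightarrow> (\<And>x. x \<in> Field P \<Longrightarrow> (z, x) \<in> P) \<Longrightarrow> zero_hat P = z"
  unfolding zero_hat_def by (rule the_equality) (auto intro: P_antisym)

lemma one_hat_eqI: "z \<in> Field P \<Longrightarrow> (\<And>x. x \<in> Field P \<Longrightarrow> (x, z) \<in> P) \<Longrightarrow> one_hat P = z"
  unfolding one_hat_def by (rule the_equality) (auto intro: P_antisym)

lemma zero_hat: "zero_hat P \<in> Field P" "x \<in> Field P \<Longrightarrow> (zero_hat P, x) \<in> P"
proof -
  obtain z where z: "z \<in> Field P" "\<And>x. x \<in> Field P \<Longrightarrow> (z, x) \<in> P"
    using bounded by (auto simp: bounded_poset_def)
  with zero_hat_eqI[OF z] show "zero_hat P \<in> Field P" "x \<in> Field P \<Longrightarrow> (zero_hat P, x) \<in> P"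
    by auto
qed

lemma one_hat: "one_hat P \<in> Field P" "x \<in> Field P \<Longrightarrow> (x, one_hat P) \<in> P"
proof -
  obtain z where z: "z \<in> Field P" "\<And>x. x \<in> Field P \<Longrightarrow> (x, z) \<in> P"
    using bounded by (auto simp: bounded_poset_def)
  with one_hat_eqI[OF z] show "one_hat P \<in> Field P" "x \<in> Field P \<Longrightarrow> (x, one_hat P) \<in> P"
    by auto
qed

lemma covers_in: "(x, y) \<in> covers P \<Longrightarrow> (x, y) \<in> P" and covers_neq: "(x, y) \<in> covers P \<Longrightarrow> x \<noteq> y"
  by (auto simp: covers_def)

lemma chain_lengths: "(x, y) \<in> P \<Longrightarrow> \<exists>m. length ` maximal_chains P x y = {Suc m}"
  using graded unfolding graded_poset_def by blast

lemma ex_chain: assumes "(x, y) \<in> P" shows "\<exists>c. c \<in> maximal_chains P x y"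
  using chain_lengths[OF assms] by (metis all_not_in_conv image_empty insert_not_empty)

lemma chain_length_unique:
  assumes "(x, y) \<in> P" "c \<in> maximal_chains P x y" "d \<in> maximal_chains P x y"
  shows "length c = length d"
proof -
  obtain m where m: "length ` maximal_chains P x y = {Suc m}" using chain_lengths[OF assms(1)] ..
  have "length c = Suc m" "length d = Suc m"
    using assms(2,3) imageI[of _ "maximal_chains P x y" length] unfolding m by blast+
  then show ?thesis by simp
qed

lemma chain_append:
  assumes "c \<in> maximal_chains P x y" "d \<in> maximal_chains P y z"
  shows "c @ tl d \<in> maximal_chains P x z"
proof -
  obtain d' where d: "d = y # d'" using assms(2) by (cases d) (auto simp: maximal_chains_def)
  have "last c = y" "c \<noteq> []" using assms(1) by (auto simp: maximal_chains_def)
  then show ?thesis using assms d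
    by (cases d') (auto simp: maximal_chains_def successively_append_iff)
qed

text \<open>Uniqueness of chain lengths resolves the definite description in \<open>rk\<close>. The
  successor appears because lists count elements, whereas rank counts covers.\<close>

lemma rk_eq:
  assumes "c \<in> maximal_chains P (zero_hat P) x" "x \<in> Field P"
  shows "length c = Suc (rk P x)"
proof -
  have "c \<noteq> []" using assms by (auto simp: maximal_chains_def)
  then obtain m where m: "length c = Suc m" by (cases c) auto
  have "rk P x = m" unfolding rk_def
  proof (rule the_equality)
    show "\<exists>c\<in>maximal_chains P (zero_hat P) x. length c = Suc m" using assms m by auto
    fix k assume "\<exists>c\<in>maximal_chains P (zero_hat P) x. length c = Suc k"
    then obtain d where "d \<in> maximal_chains P (zero_hat P) x" "length d = Suc k" by blast
    then show "k = m" using m chain_length_unique[OF zero_hat(2)[OF assms(2)] assms(1)] by simp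
  qed
  with m show ?thesis by simp
qed

text \<open>Prepending a maximal chain from the bottom to \<open>x\<close> reduces this to
  \<open>rk_eq\<close> at \<open>x\<close> and at \<open>y\<close>. The additive form avoids
  truncated subtraction.\<close>

lemma chain_length:
  assumes "(x, y) \<in> P" "c \<in> maximal_chains P x y"
  shows "length c + rk P x = Suc (rk P y)"
proof -
  obtain d where d: "d \<in> maximal_chains P (zero_hat P) x"
    using ex_chain zero_hat assms(1) Field1 by blast
  have "length d = Suc (rk P x)" using rk_eq d Field1 assms by blast
  moreover have "length (d @ tl c) = Suc (rk P y)"
    using rk_eq chain_append d assms Field2 by blast
  moreover have "c \<noteq> []" using assms by (auto simp: maximal_chains_def)
  ultimately show ?thesis by (cases c) auto
qed

lemma rk_cover: assumes "(x, y) \<in> covers P" shows "rk P y = Suc (rk P x)"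
proof -
  have "[x, y] \<in> maximal_chains P x y"
    using assms covers_in[OF assms] by (simp add: maximal_chains_def Field1 Field2)
  from chain_length[OF covers_in[OF assms] this] show ?thesis by simp
qed

lemma chain_rest:
  assumes "x # y # c \<in> maximal_chains P x' z"
  shows "x' = x" "(x, y) \<in> covers P" "y # c \<in> maximal_chains P y z"
  using assms by (auto simp: maximal_chains_def)

lemma rk_less: assumes "(x, y) \<in> P" "x \<noteq> y" shows "rk P x < rk P y"
proof -
  obtain c where c: "c \<in> maximal_chains P x y" using ex_chain assms by blast
  then obtain a b c' where "c = a # b # c'" using assms(2)
    by (cases c rule: remdups_adj.cases) (auto simp: maximal_chains_def)
  with chain_length[OF assms(1) c] show ?thesis by auto
qed

lemma rk_mono: "(x, y) \<in> P \<Longrightarrow> rk P x \<le> rk P y"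
  using rk_less by (cases "x = y") (auto simp: less_imp_le)

text \<open>A rank difference of one leaves room only for a two-element maximal chain, which is then
  the cover itself. Cover questions thereby become rank arithmetic.\<close>

lemma covers_iff: "(x, y) \<in> covers P \<longleftrightarrow> (x, y) \<in> P \<and> rk P y = Suc (rk P x)"
proof safe
  assume a: "(x, y) \<in> P" "rk P y = Suc (rk P x)"
  obtain c where c: "c \<in> maximal_chains P x y" using ex_chain a by blast
  with chain_length[OF a(1) c] a(2) have "length c = 2" by simp
  then obtain u v where "c = [u, v]" by (auto simp: numeral_2_eq_2 length_Suc_conv)
  with c show "(x, y) \<in> covers P" by (auto simp: maximal_chains_def)
qed (auto simp: rk_cover covers_in)

lemma chain_le: "c \<in> maximal_chains P x y \<Longrightarrow> (x, y) \<in> P"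
proof (induction c arbitrary: x rule: induct_list012)
  case 1 then show ?case by (simp add: maximal_chains_def)
next
  case (2 a) then show ?case by (auto simp: maximal_chains_def P_refl)
next
  case (3 a b c)
  then show ?case using chain_rest[OF 3(3)] P_trans covers_in by blast
qed

lemma chain_rk_nth:
  "c \<in> maximal_chains P x y \<Longrightarrow> i < length c \<Longrightarrow> rk P (c ! i) = rk P x + i"
proof (induction c arbitrary: x i rule: induct_list012)
  case 1 then show ?case by simp
next
  case (2 a) then show ?case by (auto simp: maximal_chains_def)
next
  case (3 a b c)
  show ?case
  proof (cases i)
    case 0 then show ?thesis using chain_rest[OF 3(3)] by simp
  next
    case (Suc k)
    then show ?thesis using chain_rest[OF 3(3)] 3(2)[of b k] 3(4) rk_cover by auto
  qed
qed

lemma rk_zero_hat: "rk P (zero_hat P) = 0"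
  using rk_eq[of "[zero_hat P]" "zero_hat P"] by (auto simp: maximal_chains_def zero_hat)

lemma rk_0_iff: "x \<in> Field P \<Longrightarrow> rk P x = 0 \<longleftrightarrow> x = zero_hat P"
  using rk_less zero_hat rk_zero_hat by (metis less_nat_zero_code)

lemma rk_one_iff: "x \<in> Field P \<Longrightarrow> rk P x = rk P (one_hat P) \<longleftrightarrow> x = one_hat P"
  using rk_less one_hat by (metis less_irrefl)

lemma full_chain_length: "c \<in> full_chains P \<Longrightarrow> length c = Suc (rk P (one_hat P))"
  by (simp add: full_chains_def one_hat rk_eq)

lemma chain_split:
  assumes "c @ z # d \<in> maximal_chains P x y"
  shows "c @ [z] \<in> maximal_chains P x z" "z # d \<in> maximal_chains P z y"
  using assms by (auto simp: maximal_chains_def successively_append_iff hd_append)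

subsection \<open>Chains of rank-selected subposets\<close>

text \<open>A chain \<open>c\<close> satisfies \<open>skips S lam R c\<close> if it ascends at each interior element whose rank
  is not in \<open>R\<close>. Such chains are recovered from their elements of rank in \<open>R\<close>, as the pieces in
  between are increasing.\<close>

fun skips :: "'l rel \<Rightarrow> ('a \<times> 'a \<Rightarrow> 'l) \<Rightarrow> nat set \<Rightarrow> 'a list \<Rightarrow> bool" where
  "skips S lam R (x # y # z # c) \<longleftrightarrow>
     (rk P y \<in> R \<or> (lam (x, y), lam (y, z)) \<in> S) \<and> skips S lam R (y # z # c)"
| "skips S lam R _ \<longleftrightarrow> True"

text \<open>The element \<open>z\<close> is exempt because its rank lies in \<open>R\<close>, so
  every remaining condition concerns only one side of the cut.\<close>

lemma skips_append:
  "rk P z \<in> R \<Longrightarrow> skips S lam R (c @ z # d) \<longleftrightarrow> skips S lam R (c @ [z]) \<and> skips S lam R (z # d)"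
proof (induction S lam R c rule: skips.induct)
  case (1 S lam R x y w c) then show ?case by auto
next
  case ("2_3" S lam R x y) then show ?case by (cases d) auto
next
  case ("2_2" S lam R x) then show ?case by (cases d) auto
qed auto

text \<open>The two ends are never tested and no interior element is exempt, so an ascent is
  demanded at every interior element.\<close>

lemma skips_increasing:
  "(\<And>y. y \<in> set c \<Longrightarrow> rk P y \<notin> R) \<Longrightarrow>
     skips S lam R (x # c @ [z]) \<longleftrightarrow> increasing_chain S lam (x # c @ [z])"
proof (induction c arbitrary: x)
  case (Cons y c) then show ?case by (cases c) (auto simp: increasing_chain_def label_word_def)
qed (simp add: increasing_chain_def label_word_def)

lemma skips_conv_nth:
  "skips S lam R c \<longleftrightarrow> (\<forall>i. Suc (Suc i) < length c \<longrightarrow> rk P (c ! Suc i) \<in> R \<or>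
      (lam (c ! i, c ! Suc i), lam (c ! Suc i, c ! Suc (Suc i))) \<in> S)"
proof (induction S lam R c rule: skips.induct)
  case (1 S lam R x y z c)
  \<comment> \<open>Separating index 0 from the successors mirrors the two conjuncts of the
    recursive equation of \<open>skips\<close>.\<close>
  have split: "(\<forall>i. Q i) \<longleftrightarrow> Q 0 \<and> (\<forall>i. Q (Suc i))" for Q :: "nat \<Rightarrow> bool"
    by (metis not0_implies_Suc)
  show ?case
    unfolding skips.simps 1 by (subst (2) split) simp
qed auto

text \<open>Along a maximal chain from \<open>x\<close> the rank grows by one per step, so the
  element at index \<open>r - rk P x\<close> has rank \<open>r\<close>.\<close>

lemma ex_rank_between:
  assumes "(x, y) \<in> P" "rk P x < r" "r < rk P y"
  shows "\<exists>z. (x, z) \<in> P \<and> (z, y) \<in> P \<and> rk P z = r"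
proof -
  obtain c where c: "c \<in> maximal_chains P x y" using ex_chain assms by blast
  let ?i = "r - rk P x"
  have i: "?i < length c" using chain_length[OF assms(1) c] assms by simp
  then have "c = take ?i c @ c ! ?i # drop (Suc ?i) c" by (rule id_take_nth_drop)
  with chain_split c have
    "take ?i c @ [c ! ?i] \<in> maximal_chains P x (c ! ?i)"
    "c ! ?i # drop (Suc ?i) c \<in> maximal_chains P (c ! ?i) y"
    by metis+
  then have "(x, c ! ?i) \<in> P" "(c ! ?i, y) \<in> P" by (auto dest: chain_le)
  moreover have "rk P (c ! ?i) = r" using chain_rk_nth[OF c i] assms by simp
  ultimately show ?thesis by blast
qed

section \<open>Rank-selected subposets and the passage between their chains and those of
  \<open>P\<close>\<close>

abbreviation sel :: "nat set \<Rightarrow> 'a rel" where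
  "sel R \<equiv> Restr P {x \<in> Field P. rk P x \<in> R}"

lemma Field_sel: "Field (sel R) = {x \<in> Field P. rk P x \<in> R}"
  by (auto simp: Field_def intro: P_refl Field1 Field2)

text \<open>The bounds are the only elements of rank 0 and of top rank, so adjoining them amounts to
  adjoining these two ranks. From here on, selection is a condition on ranks alone.\<close>

lemma rank_selected_eq: "rank_selected P J = sel (insert 0 (insert (rk P (one_hat P)) J))"
proof -
  have "{x \<in> Field P. rk P x \<in> J} \<union> {zero_hat P, one_hat P}
      = {x \<in> Field P. rk P x \<in> insert 0 (insert (rk P (one_hat P)) J)}"
    by (auto simp: rk_0_iff rk_one_iff rk_zero_hat zero_hat(1) one_hat(1))
  then show ?thesis by (simp only: rank_selected_def)
qed

text \<open>Every rank strictly between those of \<open>x\<close> and \<open>y\<close> is attained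
  inside the interval, so a rank of \<open>R\<close> in the gap would produce a selected element
  strictly between.\<close>

lemma covers_sel:
  "(x, y) \<in> covers (sel R) \<longleftrightarrow> (x, y) \<in> P \<and> rk P x < rk P y \<and> rk P x \<in> R \<and> rk P y \<in> R \<and>
     (\<forall>r\<in>R. \<not> (rk P x < r \<and> r < rk P y))" (is "?l \<longleftrightarrow> ?r")
proof
  assume l: ?l
  then have xy: "(x, y) \<in> P" "x \<noteq> y" "rk P x \<in> R" "rk P y \<in> R" by (auto simp: covers_def)
  have False if r: "r \<in> R" "rk P x < r" "r < rk P y" for r
  proof -
    obtain z where z: "(x, z) \<in> P" "(z, y) \<in> P" "rk P z = r"
      using ex_rank_between[OF xy(1) r(2,3)] by blast
    with r have "x \<noteq> z" "z \<noteq> y" by auto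
    with z r xy l show False by (auto simp: covers_def Field1 Field2)
  qed
  with xy rk_less show ?r by blast
next
  assume ?r
  then show ?l by (auto simp: covers_def Field1 Field2 dest: rk_less)
qed

text \<open>Cutting at the first selected element after \<open>x\<close> is the inductive step for
  comparing chains of \<open>P\<close> with chains of \<open>sel R\<close>. The ranks strictly
  between \<open>x\<close> and \<open>x'\<close> are exactly those occurring in \<open>m\<close>,
  which makes the pair a cover of \<open>sel R\<close>.\<close>

lemma first_selected:
  assumes "c \<in> maximal_chains P x y" "x \<noteq> y" "rk P x \<in> R" "rk P y \<in> R"
  obtains m x' d where "c = x # m @ x' # d" "\<forall>w\<in>set m. rk P w \<notin> R"
    "x # m @ [x'] \<in> maximal_chains P x x'" "x' # d \<in> maximal_chains P x' y"
    "(x, x') \<in> covers (sel R)"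
proof -
  obtain c' where c': "c = x # c'" using assms(1) by (cases c) (auto simp: maximal_chains_def)
  have "c' \<noteq> []" "last c' = y" using assms(1,2) c' by (auto simp: maximal_chains_def split: if_splits)
  then have "\<exists>w\<in>set c'. rk P w \<in> R" using assms(4) last_in_set by blast
  then obtain m x' d where m: "c' = m @ x' # d" "rk P x' \<in> R" "\<forall>w\<in>set m. rk P w \<notin> R"
    using split_list_first_prop[of c' "\<lambda>w. rk P w \<in> R"] by blast
  have sp: "x # m @ [x'] \<in> maximal_chains P x x'" "x' # d \<in> maximal_chains P x' y"
    using chain_split[of "x # m" x' d x y] assms(1) c' m by auto
  have le: "(x, x') \<in> P" using sp(1) by (rule chain_le)
  have len: "Suc (length m) + rk P x = rk P x'" using chain_length[OF le sp(1)] by simp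
  have "r \<notin> R" if r: "rk P x < r" "r < rk P x'" for r
  proof -
    \<comment> \<open>The list \<open>m\<close> starts one rank above \<open>x\<close>, hence the
      shift by \<open>Suc\<close>.\<close>
    let ?i = "r - Suc (rk P x)"
    have i: "?i < length m" using r len by simp
    then have "rk P (m ! ?i) = r"
      using chain_rk_nth[OF sp(1), of "Suc ?i"] r by (simp add: nth_append)
    with i m(3) show ?thesis by (metis nth_mem)
  qed
  then have "(x, x') \<in> covers (sel R)" using le len m(2) assms(3) by (auto simp: covers_sel)
  with c' m sp show thesis by (intro that[of m x' d]) simp_all
qed

lemma chain_same: "c \<in> maximal_chains P x x \<longleftrightarrow> c = [x] \<and> x \<in> Field P"
proof
  assume c: "c \<in> maximal_chains P x x"
  with chain_length[OF chain_le[OF c] c] show "c = [x] \<and> x \<in> Field P"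
    by (auto simp: maximal_chains_def length_Suc_conv)
qed (auto simp: maximal_chains_def)

text \<open>Each piece between successive selected elements collapses to a cover of
  \<open>sel R\<close>; the rest of the chain is shorter and again starts at a selected
  element.\<close>

lemma filter_chain:
  assumes "c \<in> maximal_chains P x y" "rk P x \<in> R" "rk P y \<in> R"
  shows "filter (\<lambda>w. rk P w \<in> R) c \<in> maximal_chains (sel R) x y"
  using assms
proof (induction "length c" arbitrary: c x rule: less_induct)
  case less
  show ?case
  proof (cases "x = y")
    case True
    with less(2) have "c = [y]" "y \<in> Field P" by (auto simp: chain_same)
    with less(4) True show ?thesis by (auto simp: maximal_chains_def Field_sel)
  next
    case False
    obtain m x' d where d: "c = x # m @ x' # d" "\<forall>w\<in>set m. rk P w \<notin> R"
      "x # m @ [x'] \<in> maximal_chains P x x'" "x' # d \<in> maximal_chains P x' y"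
      "(x, x') \<in> covers (sel R)"
      by (rule first_selected[OF less(2) False less(3,4)])
    have x': "rk P x' \<in> R" using d(5) by (simp add: covers_sel)
    have "filter (\<lambda>w. rk P w \<in> R) (x' # d) \<in> maximal_chains (sel R) x' y"
      using less(1)[OF _ d(4) x' less(4)] d(1) by simp
    moreover have "filter (\<lambda>w. rk P w \<in> R) m = []" using d(2) by (simp add: filter_empty_conv)
    moreover have "x \<in> Field (sel R)" using d(5) by (auto simp: covers_def Field_def)
    ultimately show ?thesis using d(1,5) x' less(3)
      by (auto simp: maximal_chains_def successively_Cons)
  qed
qed

text \<open>Equal filtered lists force the same next selected element. The pieces leading to it are
  both increasing, hence equal by uniqueness, and the induction continues with the
  remainders.\<close>

lemma filter_chain_inj:
  assumes unique: "\<And>x y. (x, y) \<in> P \<Longrightarrow> \<exists>!c. c \<in> maximal_chains P x y \<and> increasing_chain S lam c"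
    and "c \<in> maximal_chains P x y" "d \<in> maximal_chains P x y" "rk P x \<in> R" "rk P y \<in> R"
    and "skips S lam R c" "skips S lam R d"
    and "filter (\<lambda>w. rk P w \<in> R) c = filter (\<lambda>w. rk P w \<in> R) d"
  shows "c = d"
  using assms(2-)
proof (induction "length c" arbitrary: c d x rule: less_induct)
  case less
  show ?case
  proof (cases "x = y")
    case True with less(2,3) show ?thesis by (simp add: chain_same)
  next
    case False
    obtain m u c' where c: "c = x # m @ u # c'" "\<forall>w\<in>set m. rk P w \<notin> R"
      "x # m @ [u] \<in> maximal_chains P x u" "u # c' \<in> maximal_chains P u y" "(x, u) \<in> covers (sel R)"
      by (rule first_selected[OF less(2) False less(4,5)])
    obtain k v d' where d: "d = x # k @ v # d'" "\<forall>w\<in>set k. rk P w \<notin> R"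
      "x # k @ [v] \<in> maximal_chains P x v" "v # d' \<in> maximal_chains P v y" "(x, v) \<in> covers (sel R)"
      by (rule first_selected[OF less(3) False less(4,5)])
    have R: "rk P u \<in> R" "rk P v \<in> R" using c(5) d(5) by (auto simp: covers_sel)
    \<comment> \<open>As \<open>m\<close> and \<open>k\<close> vanish under filtering, the second
      entries of the filtered lists are \<open>u\<close> and \<open>v\<close>.\<close>
    have "filter (\<lambda>w. rk P w \<in> R) m = []" "filter (\<lambda>w. rk P w \<in> R) k = []"
      using c(2) d(2) by (auto simp: filter_empty_conv)
    with less(8) R c(1) d(1) less(4) have
      uv: "u = v" and f: "filter (\<lambda>w. rk P w \<in> R) (u # c') = filter (\<lambda>w. rk P w \<in> R) (v # d')"
      by auto
    have sk: "skips S lam R (x # m @ [u])" "skips S lam R (u # c')"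
      "skips S lam R (x # k @ [v])" "skips S lam R (v # d')"
      using less(6,7) skips_append[OF R(1), of S lam "x # m" c']
        skips_append[OF R(2), of S lam "x # k" d'] c(1) d(1) by auto
    then have "increasing_chain S lam (x # m @ [u])" "increasing_chain S lam (x # k @ [u])"
      using skips_increasing[of m R S lam x u] skips_increasing[of k R S lam x u] c(2) d(2) uv by auto
    with unique[OF chain_le[OF c(3)]] c(3) d(3) uv have "m = k" by blast
    moreover have "u # c' = v # d'"
      using less(1)[OF _ c(4) _ R(1) less(5) sk(2) _ f] d(4) uv sk(4) c(1) by auto
    ultimately show ?thesis using c(1) d(1) by simp
  qed
qed

text \<open>Each cover of \<open>sel R\<close> is refined by an increasing chain of
  \<open>P\<close>. Such a refinement adds no selected element, so filtering gives back
  \<open>e\<close>.\<close>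

lemma filter_chain_surj:
  assumes ex: "\<And>x y. (x, y) \<in> P \<Longrightarrow> \<exists>c. c \<in> maximal_chains P x y \<and> increasing_chain S lam c"
    and "e \<in> maximal_chains (sel R) x y"
  shows "\<exists>c. c \<in> maximal_chains P x y \<and> skips S lam R c \<and> filter (\<lambda>w. rk P w \<in> R) c = e"
  using assms(2)
proof (induction e arbitrary: x rule: induct_list012)
  case 1 then show ?case by (simp add: maximal_chains_def)
next
  case (2 a)
  then have "a = x" "a = y" "x \<in> Field P" "rk P x \<in> R"
    using Field_sel[of R] by (auto simp: maximal_chains_def)
  then show ?case by (intro exI[of _ "[x]"]) (auto simp: maximal_chains_def)
next
  case (3 a b e)
  from 3(3) have e: "a = x" "(x, b) \<in> covers (sel R)" "b # e \<in> maximal_chains (sel R) b y"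
    by (auto simp: maximal_chains_def)
  obtain c where c: "c \<in> maximal_chains P b y" "skips S lam R c"
    "filter (\<lambda>w. rk P w \<in> R) c = b # e" using 3(2)[OF e(3)] by blast
  have xb: "(x, b) \<in> P" "x \<noteq> b" "rk P x \<in> R" "rk P b \<in> R" using e(2) by (auto simp: covers_sel)
  obtain d where d: "d \<in> maximal_chains P x b" "increasing_chain S lam d" using ex[OF xb(1)] by blast
  obtain m x' k where m: "d = x # m @ x' # k" "\<forall>w\<in>set m. rk P w \<notin> R"
    "x # m @ [x'] \<in> maximal_chains P x x'" "x' # k \<in> maximal_chains P x' b"
    "(x, x') \<in> covers (sel R)"
    by (rule first_selected[OF d(1) xb(2-4)])
  \<comment> \<open>Otherwise the rank of \<open>x'\<close> would be a rank of \<open>R\<close>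
    strictly inside the cover from \<open>x\<close> to \<open>b\<close> of
    \<open>sel R\<close>.\<close>
  have "x' = b"
  proof (rule ccontr)
    assume "x' \<noteq> b"
    then have "rk P x' < rk P b" using rk_less chain_le m(4) by blast
    moreover have "rk P x < rk P x'" "rk P x' \<in> R" using m(5) by (auto simp: covers_sel)
    ultimately show False using e(2) by (auto simp: covers_sel)
  qed
  with m(4) have "k = []" by (simp add: chain_same)
  with m \<open>x' = b\<close> have deq: "d = x # m @ [b]" by simp
  obtain c' where c': "c = b # c'" using c(1) by (cases c) (auto simp: maximal_chains_def)
  have "d @ c' \<in> maximal_chains P x y" using chain_append[OF d(1) c(1)] c' by simp
  moreover have "skips S lam R (x # m @ [b])"
    using skips_increasing[of m R S lam x b] m(2) d(2) deq by simp
  then have "skips S lam R (d @ c')"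
    using skips_append[OF xb(4), of S lam "x # m" c'] deq c(2) c' by simp
  moreover have "filter (\<lambda>w. rk P w \<in> R) m = []" using m(2) by (simp add: filter_empty_conv)
  then have "filter (\<lambda>w. rk P w \<in> R) (d @ c') = x # b # e" using deq xb(3) c(3) c' by simp
  ultimately show ?case using e(1) by blast
qed

section \<open>Counting maximal chains by their descent sets\<close>

lemma skips_iff_Des:
  assumes c: "c \<in> full_chains P"
  shows "skips S lam (insert 0 (insert (rk P (one_hat P)) J)) c \<longleftrightarrow> Des S lam c \<subseteq> J"
proof -
  let ?n = "rk P (one_hat P)"
  have len: "length c = Suc ?n" using c by (rule full_chain_length)
  have rk: "rk P (c ! i) = i" if "i \<le> ?n" for i
    using chain_rk_nth[of c "zero_hat P" "one_hat P" i] c that len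
    by (simp add: full_chains_def rk_zero_hat)
  have Suc_in_Des: "Suc i \<in> Des S lam c \<longleftrightarrow> Suc i < ?n \<and>
      (lam (c ! i, c ! Suc i), lam (c ! Suc i, c ! Suc (Suc i))) \<notin> S" for i
    by (auto simp: Des_def Asc_def Let_def len label_word_nth)
  have "0 \<notin> Des S lam c" by (simp add: Des_def)
  then have "Des S lam c \<subseteq> J \<longleftrightarrow> (\<forall>i. Suc i \<in> Des S lam c \<longrightarrow> Suc i \<in> J)"
    by (metis not0_implies_Suc subsetD subsetI)
  \<comment> \<open>The element at index \<open>Suc i\<close> of a full chain has rank
    \<open>Suc i\<close>. Being interior, it has neither rank 0 nor top rank, so the two adjoined
    ranks exempt nothing.\<close>
  moreover have "(Suc (Suc i) < length c \<longrightarrow>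
      rk P (c ! Suc i) \<in> insert 0 (insert ?n J) \<or>
      (lam (c ! i, c ! Suc i), lam (c ! Suc i, c ! Suc (Suc i))) \<in> S)
    \<longleftrightarrow> (Suc i \<in> Des S lam c \<longrightarrow> Suc i \<in> J)" for i
    using Suc_in_Des[of i] rk[of "Suc i"] len by auto
  ultimately show ?thesis unfolding skips_conv_nth by simp
qed

text \<open>Filtering by the selected ranks is a bijection from the full chains without descents
  outside \<open>J\<close> onto the maximal chains of the rank-selected subposet. For infinite sets
  both cardinalities are 0 by convention.\<close>

lemma alpha_eq_card_Des:
  assumes "\<And>x y. (x, y) \<in> P \<Longrightarrow> \<exists>!c. c \<in> maximal_chains P x y \<and> increasing_chain S lam c"
  shows "alpha P J = card {c \<in> full_chains P. Des S lam c \<subseteq> J}"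
proof -
  let ?R = "insert 0 (insert (rk P (one_hat P)) J)"
  let ?A = "{c \<in> full_chains P. skips S lam ?R c}"
  have "bij_betw (filter (\<lambda>w. rk P w \<in> ?R)) ?A (maximal_chains (sel ?R) (zero_hat P) (one_hat P))"
  proof (rule bij_betw_imageI)
    show "inj_on (filter (\<lambda>w. rk P w \<in> ?R)) ?A"
    proof (rule inj_onI)
      fix c d assume "c \<in> ?A" "d \<in> ?A"
        "filter (\<lambda>w. rk P w \<in> ?R) c = filter (\<lambda>w. rk P w \<in> ?R) d"
      then show "c = d"
        by (intro filter_chain_inj[of S lam c "zero_hat P" "one_hat P" d ?R] assms)
          (auto simp: full_chains_def rk_zero_hat)
    qed
    show "filter (\<lambda>w. rk P w \<in> ?R) ` ?A = maximal_chains (sel ?R) (zero_hat P) (one_hat P)"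
    proof safe
      fix c assume "c \<in> full_chains P"
      then show "filter (\<lambda>w. rk P w \<in> ?R) c \<in> maximal_chains (sel ?R) (zero_hat P) (one_hat P)"
        by (intro filter_chain) (auto simp: full_chains_def rk_zero_hat)
    next
      fix e assume e: "e \<in> maximal_chains (sel ?R) (zero_hat P) (one_hat P)"
      show "e \<in> filter (\<lambda>w. rk P w \<in> ?R) ` ?A"
        using filter_chain_surj[OF ex1_implies_ex[OF assms] e] by (auto simp: full_chains_def)
    qed
  qed
  then have "card ?A = alpha P J"
    unfolding alpha_def rank_selected_eq by (rule bij_betw_same_card)
  moreover have "?A = {c \<in> full_chains P. Des S lam c \<subseteq> J}" using skips_iff_Des by blast
  ultimately show ?thesis by simp
qed

text \<open>Grouping chains by their exact descent set writes \<open>alpha\<close> as a sum over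
  subsets, which Moebius inversion undoes. Finiteness makes \<open>card\<close> additive over this
  grouping.\<close>

lemma beta_eq_card_Des:
  assumes unique: "\<And>x y. (x, y) \<in> P \<Longrightarrow> \<exists>!c. c \<in> maximal_chains P x y \<and> increasing_chain S lam c"
    and fin: "finite (full_chains P)" and J: "finite J"
  shows "beta P J = int (card {c \<in> full_chains P. Des S lam c = J})"
  unfolding beta_def
proof (rule inclusion_exclusion_mobius[symmetric, OF _ J])
  fix U :: "nat set" assume "finite U"
  have "{c \<in> full_chains P. Des S lam c \<subseteq> U} = (\<Union>V\<in>Pow U. {c \<in> full_chains P. Des S lam c = V})"
    by auto
  also have "card \<dots> = (\<Sum>V\<in>Pow U. card {c \<in> full_chains P. Des S lam c = V})"
    using fin \<open>finite U\<close> by (intro card_UN_disjoint) auto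
  finally show "int (alpha P U) = (\<Sum>V\<in>Pow U. int (card {c \<in> full_chains P. Des S lam c = V}))"
    by (simp add: alpha_eq_card_Des[OF unique])
qed

lemma finite_full_chains:
  assumes "finite (Field P)"
  shows "finite (full_chains P)"
proof (rule finite_subset)
  show "full_chains P \<subseteq> {c. set c \<subseteq> Field P \<and> length c = Suc (rk P (one_hat P))}"
    using full_chain_length by (auto simp: full_chains_def maximal_chains_def)
qed (rule finite_lists_length_eq[OF assms])

end

subsection \<open>Segre powers\<close>

lemma tuple_power_iff:
  "(xs, ys) \<in> tuple_power t r \<longleftrightarrow> length xs = t \<and> length ys = t \<and> (\<forall>i<t. (xs ! i, ys ! i) \<in> r)"
  by (auto simp: tuple_power_def listrel_iff_nth)

lemma power_labeling_nth:
  "length xs = t \<Longrightarrow> length ys = t \<Longrightarrow> i < t \<Longrightarrow> power_labeling lam (xs, ys) ! i = lam (xs ! i, ys ! i)"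
  by (simp add: power_labeling_def)

lemma length_power_labeling:
  "length xs = t \<Longrightarrow> length ys = t \<Longrightarrow> length (power_labeling lam (xs, ys)) = t"
  by (simp add: power_labeling_def)

section \<open>Ascents by index; projecting chains of tuples and weaving them together\<close>

lemma increasing_chain_conv_nth:
  "increasing_chain S lam c \<longleftrightarrow> (\<forall>j. Suc (Suc j) < length c \<longrightarrow>
     (lam (c ! j, c ! Suc j), lam (c ! Suc j, c ! Suc (Suc j))) \<in> S)"
  by (auto simp: increasing_chain_def successively_conv_nth label_word_nth less_diff_conv)

lemma Suc_in_Asc:
  "Suc j \<in> Asc S lam c \<longleftrightarrow> Suc (Suc j) < length c \<and>
     (lam (c ! j, c ! Suc j), lam (c ! Suc j, c ! Suc (Suc j))) \<in> S"
  by (auto simp: Asc_def Let_def label_word_nth)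

lemma zero_notin_Asc: "0 \<notin> Asc S lam c"
  by (simp add: Asc_def Let_def)

text \<open>Projection to one coordinate, with entries readable by index;
  \<open>transpose_eq_coord\<close> relates it to \<open>transpose\<close>.\<close>

definition coord :: "'b list list \<Rightarrow> nat \<Rightarrow> 'b list" where
  "coord C i = map (\<lambda>v. v ! i) C"

lemma length_coord [simp]: "length (coord C i) = length C"
  by (simp add: coord_def)

lemma coord_nth [simp]: "j < length C \<Longrightarrow> coord C i ! j = C ! j ! i"
  by (simp add: coord_def)

text \<open>The list of \<open>m\<close> tuples whose projection to coordinate \<open>i\<close> is
  \<open>c i\<close> when that list has length \<open>m\<close>. A function in place of a list of
  lists accepts chains chosen separately for each coordinate.\<close>

definition weave :: "nat \<Rightarrow> nat \<Rightarrow> (nat \<Rightarrow> 'b list) \<Rightarrow> 'b list list" where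
  "weave t m c = map (\<lambda>j. map (\<lambda>i. c i ! j) [0..<t]) [0..<m]"

lemma length_weave [simp]: "length (weave t m c) = m"
  by (simp add: weave_def)

lemma weave_nth [simp]: "j < m \<Longrightarrow> weave t m c ! j = map (\<lambda>i. c i ! j) [0..<t]"
  by (simp add: weave_def)

lemma transpose_eq_coord:
  assumes "C \<noteq> []" "\<And>v. v \<in> set C \<Longrightarrow> length v = t"
  shows "transpose C = map (coord C) [0..<t]"
proof -
  have "transpose C = map (\<lambda>i. map (\<lambda>j. C ! j ! i) [0..<length C]) [0..<t]"
    by (rule transpose_rectangle) (use assms in auto)
  also have "\<dots> = map (coord C) [0..<t]"
    by (auto intro: nth_equalityI)
  finally show ?thesis .
qed

lemma transpose_eq_weave:
  assumes "cs \<noteq> []" "\<And>c. c \<in> set cs \<Longrightarrow> length c = m"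
  shows "transpose cs = weave (length cs) m (\<lambda>i. cs ! i)"
  unfolding weave_def by (rule transpose_rectangle) (use assms in auto)

section \<open>The Segre power as a bounded graded poset\<close>

locale segre_power_poset = bounded_graded_poset P for P :: "'a rel" +
  fixes t :: nat
  assumes t_pos: "t \<ge> 1"
begin

abbreviation Q :: "'a list rel" where "Q \<equiv> segre_power t P"

lemma Q_iff:
  "(xs, ys) \<in> Q \<longleftrightarrow> length xs = t \<and> length ys = t \<and> (\<forall>i<t. (xs ! i, ys ! i) \<in> P) \<and>
     (\<forall>i<t. \<forall>j<t. rk P (xs ! i) = rk P (xs ! j)) \<and> (\<forall>i<t. \<forall>j<t. rk P (ys ! i) = rk P (ys ! j))"
proof (cases "length xs = t \<and> length ys = t")
  case True
  then have len: "length xs = t" "length ys = t" by auto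
  show ?thesis
    unfolding segre_power_def Int_iff mem_Sigma_iff mem_Collect_eq tuple_power_iff
      all_set_conv_all_nth len by blast
next
  case False
  then show ?thesis unfolding segre_power_def tuple_power_iff Int_iff by blast
qed

lemma Field_Q: "xs \<in> Field Q \<longleftrightarrow> (xs, xs) \<in> Q"
proof
  assume "xs \<in> Field Q"
  then obtain ys where "(xs, ys) \<in> Q \<or> (ys, xs) \<in> Q" by (auto simp: Field_def)
  then show "(xs, xs) \<in> Q" unfolding Q_iff by (meson P_refl Field1 Field2)
qed (auto simp: Field_def)

lemma Field_Q_iff:
  "xs \<in> Field Q \<longleftrightarrow> length xs = t \<and> (\<forall>i<t. xs ! i \<in> Field P) \<and>
     (\<forall>i<t. \<forall>j<t. rk P (xs ! i) = rk P (xs ! j))"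
proof -
  have "(x, x) \<in> P \<longleftrightarrow> x \<in> Field P" for x using P_refl Field1 by blast
  then show ?thesis unfolding Field_Q Q_iff by blast
qed

lemma Q_Field: assumes "(xs, ys) \<in> Q" shows "xs \<in> Field Q" "ys \<in> Field Q"
  using assms by (auto simp: Field_def)

lemma Q_length: assumes "(xs, ys) \<in> Q" shows "length xs = t" "length ys = t"
  using assms unfolding Q_iff by blast+

lemma Q_nth: "(xs, ys) \<in> Q \<Longrightarrow> i < t \<Longrightarrow> (xs ! i, ys ! i) \<in> P"
  unfolding Q_iff by blast

text \<open>Since \<open>t\<close> is positive, coordinate 0 exists, and its rank represents the
  common rank of the tuple.\<close>

lemma Field_rk: "xs \<in> Field Q \<Longrightarrow> i < t \<Longrightarrow> rk P (xs ! i) = rk P (xs ! 0)"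
  using t_pos unfolding Field_Q_iff by (metis less_le_trans zero_less_one)

lemma Partial_order_Q: "Partial_order Q"
  unfolding partial_order_on_def preorder_on_def
proof (intro conjI)
  show "Q \<subseteq> Field Q \<times> Field Q" by (auto simp: Field_def)
  show "Refl Q" by (simp add: refl_on_def Field_Q)
  show "trans Q"
  proof (rule transI)
    fix xs ys zs assume "(xs, ys) \<in> Q" "(ys, zs) \<in> Q"
    then show "(xs, zs) \<in> Q" unfolding Q_iff by (meson P_trans)
  qed
  show "antisym Q"
  proof (rule antisymI)
    fix xs ys assume "(xs, ys) \<in> Q" "(ys, xs) \<in> Q"
    then show "xs = ys" unfolding Q_iff by (metis P_antisym nth_equalityI)
  qed
qed

lemma Field_length: "xs \<in> Field Q \<Longrightarrow> length xs = t"
  and Field_nth: "xs \<in> Field Q \<Longrightarrow> i < t \<Longrightarrow> xs ! i \<in> Field P"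
  unfolding Field_Q_iff by blast+

lemma Q_I: "xs \<in> Field Q \<Longrightarrow> ys \<in> Field Q \<Longrightarrow> (\<And>i. i < t \<Longrightarrow> (xs ! i, ys ! i) \<in> P) \<Longrightarrow> (xs, ys) \<in> Q"
  unfolding Q_iff Field_Q_iff by blast

lemma zero_one_Field_Q: "replicate t (zero_hat P) \<in> Field Q" "replicate t (one_hat P) \<in> Field Q"
  by (auto simp: Field_Q_iff zero_hat one_hat)

lemma zero_Q: "xs \<in> Field Q \<Longrightarrow> (replicate t (zero_hat P), xs) \<in> Q"
  by (rule Q_I[OF zero_one_Field_Q(1)]) (auto simp: zero_hat Field_nth)

lemma one_Q: "xs \<in> Field Q \<Longrightarrow> (xs, replicate t (one_hat P)) \<in> Q"
  by (rule Q_I[OF _ zero_one_Field_Q(2)]) (auto simp: one_hat Field_nth)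

lemma bounded_Q: "bounded_poset Q"
  unfolding bounded_poset_def using Partial_order_Q zero_Q one_Q zero_one_Field_Q by blast

text \<open>Distinct tuples differ in some coordinate, where the rank rises strictly; ranks agree
  across each tuple, so it rises in all coordinates.\<close>

lemma Q_rk_less:
  assumes "(xs, ys) \<in> Q" "xs \<noteq> ys" "i < t"
  shows "rk P (xs ! i) < rk P (ys ! i)"
proof -
  obtain k where k: "k < t" "xs ! k \<noteq> ys ! k"
    using assms(2) Q_length[OF assms(1)] nth_equalityI[of xs ys] by auto
  then have "rk P (xs ! k) < rk P (ys ! k)" using Q_nth[OF assms(1)] rk_less by simp
  then show ?thesis
    using Q_Field[OF assms(1)] Field_rk[OF _ k(1)] Field_rk[OF _ assms(3)] by simp
qed

text \<open>If the common rank jumped by more than one, choosing an element of the next rank in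
  every coordinate would give a tuple strictly between. Conversely, an intermediate tuple would need
  two strict rank increases in coordinate 0, where a cover allows one.\<close>

lemma covers_Q:
  "(xs, ys) \<in> covers Q \<longleftrightarrow> xs \<in> Field Q \<and> ys \<in> Field Q \<and> (\<forall>i<t. (xs ! i, ys ! i) \<in> covers P)"
proof
  assume l: "(xs, ys) \<in> covers Q"
  then have Q: "(xs, ys) \<in> Q" "xs \<noteq> ys" by (auto simp: covers_def)
  note less = Q_rk_less[OF Q]
  have F: "xs \<in> Field Q" "ys \<in> Field Q" using Q by (auto simp: Field_def)
  have "rk P (ys ! 0) = Suc (rk P (xs ! 0))"
  proof (rule ccontr)
    assume ne: "rk P (ys ! 0) \<noteq> Suc (rk P (xs ! 0))"
    \<comment> \<open>With the bound on \<open>i\<close> inside the existential, the choice function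
      is defined for all indices.\<close>
    have "\<forall>i. \<exists>z. i < t \<longrightarrow> (xs ! i, z) \<in> P \<and> (z, ys ! i) \<in> P \<and> rk P z = Suc (rk P (xs ! 0))"
    proof
      fix i
      show "\<exists>z. i < t \<longrightarrow> (xs ! i, z) \<in> P \<and> (z, ys ! i) \<in> P \<and> rk P z = Suc (rk P (xs ! 0))"
      proof (cases "i < t")
        case True
        then have r: "rk P (xs ! i) = rk P (xs ! 0)" "rk P (ys ! i) = rk P (ys ! 0)" "(xs ! i, ys ! i) \<in> P"
          using F True Q_nth[OF Q(1)] by (auto intro: Field_rk)
        with ne less[OF True] show ?thesis
          using ex_rank_between[of "xs ! i" "ys ! i" "Suc (rk P (xs ! 0))"] by auto
      qed simp
    qed
    then obtain z where z: "\<And>i. i < t \<Longrightarrow> (xs ! i, z i) \<in> P \<and> (z i, ys ! i) \<in> P \<and>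
        rk P (z i) = Suc (rk P (xs ! 0))" by metis
    let ?z = "map z [0..<t]"
    have "?z \<in> Field Q" using z by (auto simp: Field_Q_iff dest: Field1)
    then have "(xs, ?z) \<in> Q" "(?z, ys) \<in> Q" using z F by (auto intro: Q_I)
    moreover have "rk P (?z ! 0) = Suc (rk P (xs ! 0))" using z[of 0] t_pos by simp
    then have "xs \<noteq> ?z" "?z \<noteq> ys" using ne by auto
    ultimately show False using l by (auto simp: covers_def)
  qed
  then have "(xs ! i, ys ! i) \<in> covers P" if "i < t" for i
    using Q_nth[OF Q(1) that] Field_rk[OF F(1) that] Field_rk[OF F(2) that] by (simp add: covers_iff)
  with F show "xs \<in> Field Q \<and> ys \<in> Field Q \<and> (\<forall>i<t. (xs ! i, ys ! i) \<in> covers P)" by blast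
next
  assume r: "xs \<in> Field Q \<and> ys \<in> Field Q \<and> (\<forall>i<t. (xs ! i, ys ! i) \<in> covers P)"
  then have Q: "(xs, ys) \<in> Q" by (auto intro: Q_I covers_in)
  have c: "(xs ! 0, ys ! 0) \<in> covers P" using r t_pos by auto
  have False if "(xs, zs) \<in> Q" "xs \<noteq> zs" "(zs, ys) \<in> Q" "zs \<noteq> ys" for zs
    using Q_rk_less[OF that(1,2), of 0] Q_rk_less[OF that(3,4), of 0] rk_cover[OF c] t_pos by simp
  with Q covers_neq[OF c] show "(xs, ys) \<in> covers Q" by (auto simp: covers_def)
qed

lemma chain_Q_tuples:
  "C \<in> maximal_chains Q xs ys \<Longrightarrow> j < length C \<Longrightarrow> length (C ! j) = t"
  unfolding maximal_chains_def by (auto intro!: Field_length dest: nth_mem)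

lemma coord_chain:
  assumes "C \<in> maximal_chains Q xs ys" "i < t"
  shows "coord C i \<in> maximal_chains P (xs ! i) (ys ! i)"
proof -
  have "set (coord C i) \<subseteq> Field P"
    using assms by (auto simp: maximal_chains_def coord_def intro: Field_nth)
  moreover have "successively (\<lambda>a b. (a, b) \<in> covers P) (coord C i)"
    unfolding coord_def successively_map
    using assms by (auto simp: maximal_chains_def covers_Q elim: successively_mono)
  ultimately show ?thesis
    using assms by (auto simp: maximal_chains_def coord_def hd_map last_map)
qed

text \<open>Constant ranks of the end tuples force all \<open>c i\<close> to have length
  \<open>m\<close>. Their entries at index \<open>j\<close> then share one rank, so they form an
  element of the Segre power.\<close>

lemma weave_chain:
  assumes xy: "(xs, ys) \<in> Q" and c: "\<And>i. i < t \<Longrightarrow> c i \<in> maximal_chains P (xs ! i) (ys ! i)"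
    and m: "m + rk P (xs ! 0) = Suc (rk P (ys ! 0))"
  shows "weave t m c \<in> maximal_chains Q xs ys" "\<And>i. i < t \<Longrightarrow> coord (weave t m c) i = c i"
proof -
  have len: "length (c i) = m" if i: "i < t" for i
    using chain_length[OF Q_nth[OF xy i] c[OF i]] m Field_rk[OF Q_Field(1)[OF xy] i]
      Field_rk[OF Q_Field(2)[OF xy] i] by simp
  have rkc: "rk P (c i ! j) = rk P (xs ! 0) + j" if "i < t" "j < m" for i j
    using chain_rk_nth[OF c[OF that(1)]] len[OF that(1)] that(2) Field_rk[OF Q_Field(1)[OF xy] that(1)] by simp
  have inF: "c i ! j \<in> Field P" if "i < t" "j < m" for i j
    using c[OF that(1)] len[OF that(1)] that(2) by (auto simp: maximal_chains_def)
  have F: "weave t m c ! j \<in> Field Q" if "j < m" for j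
    using that inF rkc t_pos by (auto simp: Field_Q_iff)
  have "rk P (xs ! 0) \<le> rk P (ys ! 0)" using rk_mono[OF Q_nth[OF xy, of 0]] t_pos by simp
  then have m0: "m > 0" using m by simp
  then have ne: "weave t m c \<noteq> []" by (metis length_weave length_0_conv less_irrefl)
  have cne: "c i \<noteq> []" if "i < t" for i using len[OF that] m0 by auto
  have "hd (weave t m c) = xs"
    unfolding hd_conv_nth[OF ne] using m0 Q_length[OF xy] c cne
    by (auto intro!: nth_equalityI simp: maximal_chains_def hd_conv_nth)
  moreover have "last (weave t m c) = ys"
    unfolding last_conv_nth[OF ne] using m0 Q_length[OF xy] c cne len
    by (auto intro!: nth_equalityI simp: maximal_chains_def last_conv_nth)
  moreover have "set (weave t m c) \<subseteq> Field Q" using F by (auto simp: in_set_conv_nth)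
  moreover have "successively (\<lambda>a b. (a, b) \<in> covers Q) (weave t m c)"
    unfolding successively_conv_nth covers_Q
  proof (intro allI impI conjI)
    fix j i assume j: "Suc j < length (weave t m c)" and i: "i < t"
    then have "(c i ! j, c i ! Suc j) \<in> covers P"
      using c[OF i] len[OF i] by (auto simp: maximal_chains_def successively_conv_nth)
    with i j show "(weave t m c ! j ! i, weave t m c ! Suc j ! i) \<in> covers P" by simp
  qed (use F in auto)
  ultimately show "weave t m c \<in> maximal_chains Q xs ys" using ne by (simp add: maximal_chains_def)
  show "\<And>i. i < t \<Longrightarrow> coord (weave t m c) i = c i"
    using len by (auto intro!: nth_equalityI)
qed

lemma chain_Q_length:
  assumes "(xs, ys) \<in> Q" "C \<in> maximal_chains Q xs ys"
  shows "length C + rk P (xs ! 0) = Suc (rk P (ys ! 0))"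
  using chain_length[OF Q_nth[OF assms(1)] coord_chain[OF assms(2)], of 0] t_pos by simp

text \<open>Weaving coordinate chains gives existence; projecting to coordinate 0 determines the
  length.\<close>

lemma graded_Q: "graded_poset Q"
  unfolding graded_poset_def
proof safe
  fix xs ys assume xy: "(xs, ys) \<in> Q"
  have "\<forall>i. \<exists>c. i < t \<longrightarrow> c \<in> maximal_chains P (xs ! i) (ys ! i)"
    using Q_nth[OF xy] ex_chain by blast
  then obtain c where c: "\<And>i. i < t \<Longrightarrow> c i \<in> maximal_chains P (xs ! i) (ys ! i)" by metis
  have le: "rk P (xs ! 0) \<le> rk P (ys ! 0)" using rk_mono[OF Q_nth[OF xy, of 0]] t_pos by simp
  let ?m = "rk P (ys ! 0) - rk P (xs ! 0)"
  have "weave t (Suc ?m) c \<in> maximal_chains Q xs ys"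
    using le by (intro weave_chain[OF xy c]) auto
  moreover have "length C = Suc ?m" if "C \<in> maximal_chains Q xs ys" for C
    using chain_Q_length[OF xy that] le by simp
  ultimately have "length ` maximal_chains Q xs ys = {Suc ?m}" by (force simp: image_iff)
  then show "\<exists>m. length ` maximal_chains Q xs ys = {Suc m}" ..
qed

text \<open>Makes the results on ranks, \<open>alpha\<close> and \<open>beta\<close> available for
  the Segre power itself.\<close>

sublocale Q: bounded_graded_poset Q
  by unfold_locales (rule bounded_Q graded_Q)+

lemma zero_hat_Q: "zero_hat Q = replicate t (zero_hat P)"
  by (rule Q.zero_hat_eqI) (auto simp: zero_one_Field_Q zero_Q)

lemma one_hat_Q: "one_hat Q = replicate t (one_hat P)"
  by (rule Q.one_hat_eqI) (auto simp: zero_one_Field_Q one_Q)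

lemma zero_one_in_Q: "(replicate t (zero_hat P), replicate t (one_hat P)) \<in> Q"
  by (simp add: zero_Q zero_one_Field_Q)

section \<open>Transposition between chains of tuples and tuples of chains\<close>

lemma chain_Q_eqI:
  assumes "C \<in> maximal_chains Q xs ys" "D \<in> maximal_chains Q us vs"
    "\<And>i. i < t \<Longrightarrow> coord C i = coord D i"
  shows "C = D"
proof (rule nth_equalityI)
  show len: "length C = length D" using assms(3)[of 0] t_pos by (metis length_coord zero_less_one order_less_le_trans)
  fix j assume j: "j < length C"
  show "C ! j = D ! j"
  proof (rule nth_equalityI)
    show "length (C ! j) = length (D ! j)"
      using chain_Q_tuples assms(1,2) j len by metis
    fix i assume "i < length (C ! j)"
    then have "i < t" using chain_Q_tuples[OF assms(1) j] by simp
    then show "C ! j ! i = D ! j ! i" using assms(3) j len by (metis coord_nth)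
  qed
qed

lemma transpose_chain_Q: "C \<in> maximal_chains Q xs ys \<Longrightarrow> transpose C = map (coord C) [0..<t]"
  by (rule transpose_eq_coord) (auto simp: maximal_chains_def intro: Field_length)

lemma transpose_chain_tuple:
  assumes "cs \<in> chain_tuples t P"
  shows "transpose cs = weave t (Suc (rk P (one_hat P))) (\<lambda>i. cs ! i)"
proof -
  have len: "length cs = t" and full: "set cs \<subseteq> full_chains P"
    using assms by (auto simp: chain_tuples_def)
  have "cs \<noteq> []" using len t_pos by auto
  then show ?thesis
    using transpose_eq_weave[of cs "Suc (rk P (one_hat P))"] full_chain_length full len by blast
qed

text \<open>Transposing is weaving between the constant tuples of bottom and top elements.\<close>

lemma transpose_tuple_chain:
  assumes cs: "cs \<in> chain_tuples t P"
  shows "transpose cs \<in> full_chains Q" "\<And>i. i < t \<Longrightarrow> coord (transpose cs) i = cs ! i"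
proof -
  let ?z = "replicate t (zero_hat P)" and ?o = "replicate t (one_hat P)"
  have c: "cs ! i \<in> maximal_chains P (?z ! i) (?o ! i)" if "i < t" for i
    using cs that nth_mem[of i cs] by (auto simp: chain_tuples_def full_chains_def)
  have m: "Suc (rk P (one_hat P)) + rk P (?z ! 0) = Suc (rk P (?o ! 0))"
    using t_pos by (simp add: rk_zero_hat)
  show "transpose cs \<in> full_chains Q" "\<And>i. i < t \<Longrightarrow> coord (transpose cs) i = cs ! i"
    using weave_chain[OF zero_one_in_Q c m]
    by (auto simp: full_chains_def zero_hat_Q one_hat_Q transpose_chain_tuple[OF cs])
qed

lemma transpose_in_tuples:
  assumes "C \<in> full_chains Q"
  shows "transpose C \<in> chain_tuples t P"
proof -
  have C: "C \<in> maximal_chains Q (replicate t (zero_hat P)) (replicate t (one_hat P))"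
    using assms by (simp add: full_chains_def zero_hat_Q one_hat_Q)
  have "coord C i \<in> full_chains P" if "i < t" for i
    using coord_chain[OF C that] that by (simp add: full_chains_def)
  then show ?thesis by (auto simp: chain_tuples_def transpose_chain_Q[OF C])
qed

lemma transpose_transpose_chain:
  assumes C: "C \<in> full_chains Q"
  shows "transpose (transpose C) = C"
proof (rule chain_Q_eqI)
  note T = transpose_tuple_chain[OF transpose_in_tuples[OF C]]
  show "transpose (transpose C) \<in> maximal_chains Q (zero_hat Q) (one_hat Q)"
    using T(1) by (simp add: full_chains_def)
  show "C \<in> maximal_chains Q (zero_hat Q) (one_hat Q)" using C by (simp add: full_chains_def)
  then show "coord (transpose (transpose C)) i = coord C i" if "i < t" for i
    using T(2)[OF that] that by (simp add: transpose_chain_Q)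
qed

lemma transpose_transpose_tuple:
  assumes cs: "cs \<in> chain_tuples t P"
  shows "transpose (transpose cs) = cs"
proof -
  have "transpose (transpose cs) = map (coord (transpose cs)) [0..<t]"
    using transpose_tuple_chain(1)[OF cs] by (simp add: full_chains_def transpose_chain_Q)
  also have "\<dots> = cs" using transpose_tuple_chain(2)[OF cs] cs
    by (auto intro!: nth_equalityI simp: chain_tuples_def)
  finally show ?thesis .
qed

text \<open>Transposition is its own inverse between the two sets, so a property of chains can be
  tested after transposing back. Leaving \<open>p\<close> arbitrary serves both the counting
  formulas and the decreasing chains.\<close>

lemma transpose_Collect:
  "transpose ` {C \<in> full_chains Q. p C} = {cs \<in> chain_tuples t P. p (transpose cs)}"
proof (intro equalityI subsetI)
  fix cs assume "cs \<in> transpose ` {C \<in> full_chains Q. p C}"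
  then obtain C where "C \<in> full_chains Q" "p C" "cs = transpose C" by blast
  with transpose_transpose_chain[of C] transpose_in_tuples[of C]
  show "cs \<in> {cs \<in> chain_tuples t P. p (transpose cs)}" by simp
next
  fix cs assume cs: "cs \<in> {cs \<in> chain_tuples t P. p (transpose cs)}"
  then have "cs = transpose (transpose cs)" "transpose cs \<in> full_chains Q"
    using transpose_transpose_tuple[of cs] transpose_tuple_chain(1)[of cs] by simp_all
  with cs show "cs \<in> transpose ` {C \<in> full_chains Q. p C}" by blast
qed

lemma inj_on_transpose: "inj_on transpose (full_chains Q)"
  by (rule inj_on_inverseI[of _ transpose]) (rule transpose_transpose_chain)

lemma bij_transpose: "bij_betw transpose (full_chains Q) (chain_tuples t P)"
  unfolding bij_betw_def using inj_on_transpose transpose_Collect[of "\<lambda>_. True"] by simp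

lemma card_tuples_Collect:
  "card {cs \<in> chain_tuples t P. p (transpose cs)} = card {C \<in> full_chains Q. p C}"
proof -
  have "inj_on transpose {C \<in> full_chains Q. p C}"
    using inj_on_transpose by (rule inj_on_subset) blast
  from card_image[OF this] show ?thesis by (simp only: transpose_Collect)
qed

end

subsection \<open>The induced labeling\<close>

text \<open>Both readings of strict inequality between label tuples are treated together through
  \<open>S\<close>; they are reconciled in \<open>ascent_iff\<close>.\<close>

locale segre_power_labeling = segre_power_poset P t for P :: "'a rel" and t +
  fixes L :: "'l rel" and lam :: "'a \<times> 'a \<Rightarrow> 'l" and S :: "'l list rel"
  assumes label_order: "Partial_order L"
    and EL: "EL_labeling P L (L - Id) lam"
    and reading:
      "S = tuple_power t (L - Id) \<or>
       (S = tuple_power t L - Id \<and>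
        (\<forall>x y z. (x, y) \<in> covers P \<and> (y, z) \<in> covers P \<longrightarrow> lam (x, y) \<noteq> lam (y, z)))"
begin

abbreviation plam :: "'a list \<times> 'a list \<Rightarrow> 'l list" where "plam \<equiv> power_labeling lam"

lemma label_in: "(x, y) \<in> covers P \<Longrightarrow> lam (x, y) \<in> Field L"
  using EL by (auto simp: EL_labeling_def)

lemma L_refl: "a \<in> Field L \<Longrightarrow> (a, a) \<in> L"
  using label_order by (auto simp: partial_order_on_def preorder_on_def refl_on_def)

lemma unique_increasing:
  "(x, y) \<in> P \<Longrightarrow> \<exists>!c. c \<in> maximal_chains P x y \<and> increasing_chain (L - Id) lam c"
  using EL unfolding EL_labeling_def by blast

lemma increasing_lex_first:
  assumes "c \<in> maximal_chains P x y" "increasing_chain (L - Id) lam c"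
    and "d \<in> maximal_chains P x y" "d \<noteq> c"
  shows "(label_word lam c, label_word lam d) \<in> lexord (L - Id)"
  using EL assms chain_le[OF assms(1)] unfolding EL_labeling_def by blast

text \<open>For coordinatewise strictness this is immediate. In the other reading consecutive labels
  differ in each coordinate, so weak inequality everywhere is already strict everywhere.\<close>

lemma ascent_iff:
  assumes "(xs, ys) \<in> covers Q" "(ys, zs) \<in> covers Q"
  shows "(plam (xs, ys), plam (ys, zs)) \<in> S \<longleftrightarrow>
    (\<forall>i<t. (lam (xs ! i, ys ! i), lam (ys ! i, zs ! i)) \<in> L - Id)"
proof -
  have len: "length xs = t" "length ys = t" "length zs = t"
    using assms by (auto simp: covers_Q intro: Field_length)
  have cov: "(xs ! i, ys ! i) \<in> covers P" "(ys ! i, zs ! i) \<in> covers P" if "i < t" for i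
    using assms that by (auto simp: covers_Q)
  have power: "(plam (xs, ys), plam (ys, zs)) \<in> tuple_power t r \<longleftrightarrow>
      (\<forall>i<t. (lam (xs ! i, ys ! i), lam (ys ! i, zs ! i)) \<in> r)" for r
    using len by (auto simp: tuple_power_iff length_power_labeling power_labeling_nth)
  show ?thesis
    using reading
  proof
    assume "S = tuple_power t (L - Id)"
    then show ?thesis by (simp only: power)
  next
    assume a: "S = tuple_power t L - Id \<and>
      (\<forall>x y z. (x, y) \<in> covers P \<and> (y, z) \<in> covers P \<longrightarrow> lam (x, y) \<noteq> lam (y, z))"
    then have neq: "lam (xs ! i, ys ! i) \<noteq> lam (ys ! i, zs ! i)" if "i < t" for i
      using cov[OF that] by blast
    \<comment> \<open>Differing in coordinate 0 suffices to make the tuples distinct, so removing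
      \<open>Id\<close> has no effect on this pair.\<close>
    have "plam (xs, ys) ! 0 \<noteq> plam (ys, zs) ! 0"
      using neq[of 0] t_pos len by (simp add: power_labeling_nth)
    then have "plam (xs, ys) \<noteq> plam (ys, zs)" by metis
    then have "(plam (xs, ys), plam (ys, zs)) \<in> S \<longleftrightarrow> (plam (xs, ys), plam (ys, zs)) \<in> tuple_power t L"
      using a by simp
    also have "\<dots> \<longleftrightarrow> (\<forall>i<t. (lam (xs ! i, ys ! i), lam (ys ! i, zs ! i)) \<in> L - Id)"
      unfolding power using neq by auto
    finally show ?thesis .
  qed
qed

lemma chain_ascent_iff:
  assumes C: "C \<in> maximal_chains Q xs ys" and j: "Suc (Suc j) < length C"
  shows "(plam (C ! j, C ! Suc j), plam (C ! Suc j, C ! Suc (Suc j))) \<in> S \<longleftrightarrow>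
    (\<forall>i<t. (lam (coord C i ! j, coord C i ! Suc j),
      lam (coord C i ! Suc j, coord C i ! Suc (Suc j))) \<in> L - Id)"
proof -
  have "(C ! j, C ! Suc j) \<in> covers Q" "(C ! Suc j, C ! Suc (Suc j)) \<in> covers Q"
    using C j by (auto simp: maximal_chains_def successively_conv_nth)
  from ascent_iff[OF this] j show ?thesis by simp
qed

lemma increasing_Q_iff:
  assumes "C \<in> maximal_chains Q xs ys"
  shows "increasing_chain S plam C \<longleftrightarrow> (\<forall>i<t. increasing_chain (L - Id) lam (coord C i))"
  unfolding increasing_chain_conv_nth length_coord
  by (simp only: chain_ascent_iff[OF assms] cong: imp_cong) blast

lemma Asc_Q:
  assumes C: "C \<in> maximal_chains Q xs ys"
  shows "Asc S plam C = (\<Inter>i<t. Asc (L - Id) lam (coord C i))"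
proof (rule set_eqI)
  fix j show "j \<in> Asc S plam C \<longleftrightarrow> j \<in> (\<Inter>i<t. Asc (L - Id) lam (coord C i))"
  proof (cases j)
    case 0
    moreover have "0 \<in> {..<t}" using t_pos by simp
    ultimately show ?thesis by (auto simp: zero_notin_Asc)
  next
    case (Suc k)
    have "j \<in> Asc S plam C \<longleftrightarrow> (\<forall>i<t. j \<in> Asc (L - Id) lam (coord C i))"
    proof (cases "Suc (Suc k) < length C")
      case True
      show ?thesis unfolding Suc Suc_in_Asc length_coord using chain_ascent_iff[OF C True] True by blast
    next
      case False
      \<comment> \<open>Out of range, no coordinate has an ascent; positivity of \<open>t\<close>
        keeps the quantifier on the right from being vacuous.\<close>
      have "0 < t" using t_pos by simp
      with False show ?thesis unfolding Suc Suc_in_Asc length_coord by blast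
    qed
    then show ?thesis by auto
  qed
qed

text \<open>Every coordinate of an increasing chain must be the unique increasing chain of its
  interval, and weaving these chains gives existence.\<close>

lemma unique_increasing_Q:
  assumes xy: "(xs, ys) \<in> Q"
  shows "\<exists>!C. C \<in> maximal_chains Q xs ys \<and> increasing_chain S plam C"
proof -
  have "\<forall>i. \<exists>c. i < t \<longrightarrow> c \<in> maximal_chains P (xs ! i) (ys ! i) \<and> increasing_chain (L - Id) lam c"
    using unique_increasing[OF Q_nth[OF xy]] by blast
  then obtain c where c: "\<And>i. i < t \<Longrightarrow> c i \<in> maximal_chains P (xs ! i) (ys ! i)"
    "\<And>i. i < t \<Longrightarrow> increasing_chain (L - Id) lam (c i)" by metis
  \<comment> \<open>Any maximal chain of the interval supplies the length for the weave.\<close>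
  obtain D where "D \<in> maximal_chains Q xs ys" using Q.ex_chain[OF xy] by blast
  note m = chain_Q_length[OF xy this]
  let ?C = "weave t (length D) c"
  have C: "?C \<in> maximal_chains Q xs ys" "\<And>i. i < t \<Longrightarrow> coord ?C i = c i"
    using weave_chain[OF xy c(1) m] by auto
  show ?thesis
  proof (rule ex1I[of _ ?C])
    show "?C \<in> maximal_chains Q xs ys \<and> increasing_chain S plam ?C"
      using C increasing_Q_iff[OF C(1)] c(2) by simp
    fix E assume E: "E \<in> maximal_chains Q xs ys \<and> increasing_chain S plam E"
    show "E = ?C"
    proof (rule chain_Q_eqI)
      show "E \<in> maximal_chains Q xs ys" "?C \<in> maximal_chains Q xs ys" using E C(1) by auto
      fix i assume i: "i < t"
      have "increasing_chain (L - Id) lam (coord E i)" using E increasing_Q_iff i by blast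
      then have "coord E i = c i"
        using unique_increasing[OF Q_nth[OF xy i]] coord_chain[of E xs ys i] E i c by blast
      then show "coord E i = coord ?C i" using C(2)[OF i] by simp
    qed
  qed
qed

section \<open>Lexicographic comparison in the Segre power\<close>

lemma label_word_coord:
  assumes "C \<in> maximal_chains Q xs ys" "i < t" "Suc j < length C"
  shows "label_word plam C ! j ! i = label_word lam (coord C i) ! j"
  using assms chain_Q_tuples[OF assms(1), of j] chain_Q_tuples[OF assms(1), of "Suc j"]
  by (simp add: label_word_nth power_labeling_nth)

text \<open>Let \<open>k\<close> be the first index where the tuple words differ. All coordinate
  words agree before \<open>k\<close>, so in no coordinate can the lexicographic comparison be
  decided earlier; at \<open>k\<close> every coordinate of the increasing chain is therefore at most
  its counterpart.\<close>

lemma increasing_Q_lex_first: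
  assumes C: "C \<in> maximal_chains Q xs ys" "increasing_chain S plam C"
    and D: "D \<in> maximal_chains Q xs ys" "D \<noteq> C"
  shows "(label_word plam C, label_word plam D) \<in> lexord (tuple_power t L - Id)"
proof -
  let ?w = "label_word plam C" and ?v = "label_word plam D"
  let ?wi = "\<lambda>i. label_word lam (coord C i)" and ?vi = "\<lambda>i. label_word lam (coord D i)"
  have len: "length C = length D" using Q.chain_length_unique[OF Q.chain_le[OF C(1)] C(1) D(1)] .
  have lex: "coord D i = coord C i \<or> (?wi i, ?vi i) \<in> lexord (L - Id)" if "i < t" for i
    using increasing_lex_first[OF coord_chain[OF C(1) that] _ coord_chain[OF D(1) that]]
      increasing_Q_iff[OF C(1)] C(2) that by blast
  \<comment> \<open>Equal tuple words give equal coordinate words, which irreflexivity of the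
    lexicographic order permits only for equal coordinate chains.\<close>
  have "?w \<noteq> ?v"
  proof
    assume eq: "?w = ?v"
    have "coord D i = coord C i" if i: "i < t" for i
    proof -
      have "?wi i = ?vi i"
      proof (rule nth_equalityI)
        show "length (?wi i) = length (?vi i)" using len by simp
        fix j assume "j < length (?wi i)"
        then have "Suc j < length C" by simp
        then show "?wi i ! j = ?vi i ! j"
          using label_word_coord[OF C(1) i] label_word_coord[OF D(1) i] eq len by metis
      qed
      then show ?thesis using lex[OF i] lexord_irreflexive[of "L - Id"] by auto
    qed
    then have "D = C" by (rule chain_Q_eqI[OF D(1) C(1)])
    with D(2) show False ..
  qed
  then have "\<exists>k. k < length ?w \<and> ?w ! k \<noteq> ?v ! k"
    using len nth_equalityI[of ?w ?v] by auto
  then obtain k where k: "k < length ?w" "?w ! k \<noteq> ?v ! k"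
    and "\<forall>j<k. \<not> (j < length ?w \<and> ?w ! j \<noteq> ?v ! j)"
    unfolding exists_least_iff[of "\<lambda>k. k < length ?w \<and> ?w ! k \<noteq> ?v ! k"] by blast
  then have least: "?w ! j = ?v ! j" if "j < k" for j using that less_trans by blast
  have kC: "Suc k < length C" using k(1) by simp
  have cov: "(C ! k, C ! Suc k) \<in> covers Q" "(D ! k, D ! Suc k) \<in> covers Q"
    using C(1) D(1) kC len by (auto simp: maximal_chains_def successively_conv_nth)
  have tup: "length (C ! k) = t" "length (C ! Suc k) = t" "length (D ! k) = t" "length (D ! Suc k) = t"
    using chain_Q_tuples[OF C(1)] chain_Q_tuples[OF D(1)] kC len by auto
  have "(?w ! k ! i, ?v ! k ! i) \<in> L" if i: "i < t" for i
  proof -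
    have wv: "?w ! j ! i = ?wi i ! j" "?v ! j ! i = ?vi i ! j" if "j \<le> k" for j
      using label_word_coord[OF C(1) i, of j] label_word_coord[OF D(1) i, of j] kC len that by auto
    \<comment> \<open>Coordinates that agree at \<open>k\<close> need reflexivity of
      \<open>L\<close>, which holds on its field.\<close>
    have inL: "?wi i ! k \<in> Field L"
      using cov(1) kC i by (simp add: label_word_nth covers_Q label_in)
    have "?wi i ! k = ?vi i ! k \<or> (?wi i ! k, ?vi i ! k) \<in> L"
      using lex[OF i]
    proof
      assume "(?wi i, ?vi i) \<in> lexord (L - Id)"
      \<comment> \<open>The words have equal length, so the proper-prefix case of
        \<open>lexord\<close> cannot occur and \<open>j\<close> is their first difference.\<close>
      then obtain j where j: "j < length (?wi i)" "take j (?wi i) = take j (?vi i)"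
        "(?wi i ! j, ?vi i ! j) \<in> L - Id"
        using len by (auto simp: lexord_take_index_conv)
      have "\<not> j < k"
      proof
        assume "j < k"
        then have "?wi i ! j = ?vi i ! j" using wv[of j] least[of j] by simp
        with j(3) show False by simp
      qed
      moreover have "?wi i ! k = ?vi i ! k" if "k < j" using j(2) that by (metis nth_take)
      ultimately show ?thesis using j(3) by (cases "j = k") auto
    qed simp
    with inL wv[of k] show ?thesis using L_refl by auto
  qed
  then have "(?w ! k, ?v ! k) \<in> tuple_power t L"
    using kC len tup by (simp add: tuple_power_iff label_word_nth length_power_labeling)
  moreover have "take k ?w = take k ?v"
    using least k(1) len by (auto intro!: nth_equalityI)
  ultimately show ?thesis
    using k len by (auto simp: lexord_take_index_conv)
qed

lemma EL_Q: "EL_labeling Q (tuple_power t L) S plam"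
proof -
  have "plam (xs, ys) \<in> Field (tuple_power t L)" if "(xs, ys) \<in> covers Q" for xs ys
  proof -
    have "length xs = t" "length ys = t" "\<And>i. i < t \<Longrightarrow> (xs ! i, ys ! i) \<in> covers P"
      using that by (auto simp: covers_Q intro: Field_length)
    then have "(plam (xs, ys), plam (xs, ys)) \<in> tuple_power t L"
      by (auto simp: tuple_power_iff length_power_labeling power_labeling_nth intro: L_refl label_in)
    then show ?thesis by (auto simp: Field_def)
  qed
  then have "plam \<in> covers Q \<rightarrow> Field (tuple_power t L)" by auto
  then show ?thesis
    unfolding EL_labeling_def
  proof (intro conjI ballI case_prodI2 impI)
    fix p xs ys assume "p \<in> Q" "p = (xs, ys)"
    then show "\<exists>!C. C \<in> maximal_chains Q xs ys \<and> increasing_chain S plam C"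
      using unique_increasing_Q by simp
  qed (assumption, rule increasing_Q_lex_first)
qed

section \<open>Descents and counting formulas for the Segre power\<close>

lemma rk_one_Q: "rk Q (one_hat Q) = rk P (one_hat P)"
proof -
  obtain C where C: "C \<in> maximal_chains Q (zero_hat Q) (one_hat Q)"
    using Q.ex_chain Q.zero_hat(2) Q.one_hat(1) by blast
  have "length C = Suc (rk Q (one_hat Q))" using Q.rk_eq[OF C Q.one_hat(1)] .
  \<comment> \<open>A full chain of tuples is as long as its projection to coordinate 0.\<close>
  moreover have "length C = Suc (rk P (one_hat P))"
    using chain_Q_length[OF Q.chain_le[OF C] C] t_pos by (simp add: zero_hat_Q one_hat_Q rk_zero_hat)
  ultimately show ?thesis by simp
qed

lemma common_ascents_transpose:
  assumes "C \<in> full_chains Q"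
  shows "common_ascents (L - Id) lam (transpose C) = Asc S plam C"
proof -
  from assms have C: "C \<in> maximal_chains Q (zero_hat Q) (one_hat Q)" by (simp add: full_chains_def)
  show ?thesis by (simp add: common_ascents_def Asc_Q[OF C] transpose_chain_Q[OF C] atLeast0LessThan)
qed

lemma common_ascents_tuple:
  assumes "cs \<in> chain_tuples t P"
  shows "common_ascents (L - Id) lam cs = Asc S plam (transpose cs)"
  using common_ascents_transpose[OF transpose_tuple_chain(1)[OF assms]]
    transpose_transpose_tuple[OF assms] by simp

lemma Des_Q:
  assumes "C \<in> full_chains Q"
  shows "Des S plam C = {1..rk P (one_hat P) - 1} - Asc S plam C"
proof -
  have "{1..<m} = {1..m - 1}" for m :: nat by auto
  with Q.full_chain_length[OF assms] show ?thesis by (simp add: Des_def rk_one_Q)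
qed

lemma alpha_Q:
  "alpha Q J = card {cs \<in> chain_tuples t P. Des S plam (transpose cs) \<subseteq> J}"
  using Q.alpha_eq_card_Des[OF unique_increasing_Q]
    card_tuples_Collect[of "\<lambda>C. Des S plam C \<subseteq> J"] by simp

lemma finite_Field_Q:
  assumes "finite (Field P)"
  shows "finite (Field Q)"
proof (rule finite_subset)
  show "Field Q \<subseteq> {xs. set xs \<subseteq> Field P \<and> length xs = t}"
    by (auto simp: in_set_conv_nth Field_length intro: Field_nth)
qed (rule finite_lists_length_eq[OF assms])

text \<open>Descents and ascents are complementary in the index set, so having descent set
  \<open>J\<close> means having ascent set the complement of \<open>J\<close>. Transposition carries
  the count over to tuples.\<close>

lemma beta_Q:
  assumes fin: "finite (Field P)" and J: "J \<subseteq> {1..rk P (one_hat P) - 1}"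
  shows "beta Q J = int (card {cs \<in> chain_tuples t P.
    {1..rk P (one_hat P) - 1} - J = common_ascents (L - Id) lam cs})"
proof -
  let ?N = "{1..rk P (one_hat P) - 1}"
  have "finite J" using J finite_subset by blast
  have "Des S plam C = J \<longleftrightarrow> ?N - J = Asc S plam C" if "C \<in> full_chains Q" for C
  proof -
    have "Asc S plam C \<subseteq> ?N"
      using Q.full_chain_length[OF that] by (auto simp: Asc_def Let_def rk_one_Q)
    with Des_Q[OF that] J show ?thesis by auto
  qed
  then have "{C \<in> full_chains Q. Des S plam C = J} = {C \<in> full_chains Q. ?N - J = Asc S plam C}"
    by blast
  moreover have "{cs \<in> chain_tuples t P. ?N - J = common_ascents (L - Id) lam cs} =
      {cs \<in> chain_tuples t P. ?N - J = Asc S plam (transpose cs)}"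
    using common_ascents_tuple by auto
  ultimately show ?thesis
    using Q.beta_eq_card_Des[OF unique_increasing_Q Q.finite_full_chains[OF finite_Field_Q[OF fin]] \<open>finite J\<close>]
      card_tuples_Collect[of "\<lambda>C. ?N - J = Asc S plam C"] by simp
qed

end

text \<open>The bijectivity of \<open>transpose\<close> expresses the identification of chains with
  tuples. The formula for \<open>beta\<close> assumes a finite poset because the inversion relies on
  additivity of \<open>card\<close>, which is 0 on infinite sets. For \<open>n = 0\<close> the index
  set \<open>{1..n - 1}\<close> is empty.\<close>

theorem theorem2p7:
  fixes P :: "'a rel" and L :: "'l rel" and lam :: "'a \<times> 'a \<Rightarrow> 'l"
    and n t :: nat and S :: "'l list rel"
  assumes "bounded_poset P" and "graded_poset P" and "rk P (one_hat P) = n"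
    and "Partial_order L"
    and "EL_labeling P L (L - Id) lam"
    and "t \<ge> 1"
    and reading:
      "S = tuple_power t (L - Id) \<or>
       (S = tuple_power t L - Id \<and>
        (\<forall>x y z. (x, y) \<in> covers P \<and> (y, z) \<in> covers P \<longrightarrow> lam (x, y) \<noteq> lam (y, z)))"
  shows
    "EL_labeling (segre_power t P) (tuple_power t L) S (power_labeling lam) \<and>
     bij_betw transpose (full_chains (segre_power t P)) (chain_tuples t P) \<and>
     (\<forall>C\<in>full_chains (segre_power t P).
        (\<forall>j\<in>{1..n - 1}. j \<in> Des S (power_labeling lam) C \<longleftrightarrow>
           \<not> (\<forall>c\<in>set (transpose C). j \<in> Asc (L - Id) lam c)) \<and>
        Des S (power_labeling lam) C =
          {1..n - 1} - (\<Inter>c\<in>set (transpose C). Asc (L - Id) lam c)) \<and>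
     transpose ` {C \<in> full_chains (segre_power t P). decreasing_chain S (power_labeling lam) C} =
       {cs \<in> chain_tuples t P. common_ascents (L - Id) lam cs = {}} \<and>
     (finite (Field P) \<longrightarrow>
        (\<forall>J\<subseteq>{1..n - 1}. beta (segre_power t P) J =
           int (card {cs \<in> chain_tuples t P. {1..n - 1} - J = common_ascents (L - Id) lam cs}))) \<and>
     (\<forall>J\<subseteq>{1..n - 1}. alpha (segre_power t P) J =
        card {cs \<in> chain_tuples t P. Des S (power_labeling lam) (transpose cs) \<subseteq> J})"
proof -
  interpret segre_power_labeling P t L lam S
    using assms by unfold_locales
  have Des: "Des S plam C = {1..n - 1} - (\<Inter>c\<in>set (transpose C). Asc (L - Id) lam c)"
    if "C \<in> full_chains Q" for C
    using Des_Q[OF that] common_ascents_transpose[OF that] \<open>rk P (one_hat P) = n\<close>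
    by (simp add: common_ascents_def)
  have "\<forall>C\<in>full_chains Q.
      (\<forall>j\<in>{1..n - 1}. j \<in> Des S plam C \<longleftrightarrow> \<not> (\<forall>c\<in>set (transpose C). j \<in> Asc (L - Id) lam c)) \<and>
      Des S plam C = {1..n - 1} - (\<Inter>c\<in>set (transpose C). Asc (L - Id) lam c)"
    using Des by auto
  moreover have "transpose ` {C \<in> full_chains Q. decreasing_chain S plam C} =
      {cs \<in> chain_tuples t P. common_ascents (L - Id) lam cs = {}}"
    unfolding transpose_Collect decreasing_chain_def using common_ascents_tuple by auto
  ultimately show ?thesis
    using EL_Q bij_transpose alpha_Q beta_Q \<open>rk P (one_hat P) = n\<close> by auto
qed

end
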